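(* Assume there is a constant $\Delta\in[0,1)$ such that for every $u\in\mathcal U$ there is a probability measure $\pi^u$ on $E$ with $$\sup_{B\in\mathcal E}|(P^u)^n(x,B)-\pi^u(B)|\le \Delta^n\qquad\text{for all } x\in E \text{ and all integers } n\ge 1 .$$ Let $u_n,u\in\mathcal U$ satisfy $u_n(x)\to u(x)$ as $n\to\infty$ for each $x\in E$, and assume that for each $x\in E$ $$\sup_{B\in\mathcal E}|P^{u_n(x)}(x,B)-P^{u(x)}(x,B)|\to 0\quad\text{as } n\to\infty .$$ Let $c:E\times U\to\mathbb R$ be bounded, measurable, and continuous with respect to the second variable. Then, as $n\to\infty$, $$\sup_{B\in\mathcal E}|\pi^{u_n}(B)-\pi^u(B)|\to 0,$$ and, for every $x\in E$, $$J_x(u_n)=\int_E c(y,u_n(y))\,\pi^{u_n}(dy)\ \to\ J_x(u)=\int_E c(y,u(y))\,\pi^u(dy).$$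
   Context: $E$ is a Polish space with Borel $\sigma$-field $\mathcal E$; $U$ is a compact set of control parameters; $\mathcal U$ is a family of Borel measurable mappings $u:E\to U$ (Markov controls). For $a\in U$, $P^a(x,\cdot)$ denotes the transition kernel on $E$ under constant control $a$. For each $u\in\mathcal U$, $(X_t^u)_{t=0,1,2,\dots}$ is the discrete-time Markov process on $E$ with transition kernel $P^{u(x)}(x,dy)$ (assumed to be a Markov kernel), $(P^u)^n$ is the $n$-th iterate of this kernel, and $E_x^u$ is expectation when the process starts at $x$. The long run average functional is $$J_x(u)=\liminf_{n\to\infty}\frac1n E_x^u\Big\{\sum_{i=0}^{n-1}c(X_i^u,u(X_i^u))\Big\}.$$ *)

theory Defs
  imports "HOL-Probability.Probability"
begin

definition sup_dist :: "'a::topological_space measure \<Rightarrow> 'a measure \<Rightarrow> real" where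
  "sup_dist \<mu> \<nu> = (SUP B\<in>sets borel. \<bar>measure \<mu> B - measure \<nu> B\<bar>)"

abbreviation markov_kernel :: "('e::topological_space \<Rightarrow> 'e measure) \<Rightarrow> bool" where
  "markov_kernel K \<equiv> K \<in> borel \<rightarrow>\<^sub>M prob_algebra borel"

definition controlled_kernel :: "('u \<Rightarrow> 'e \<Rightarrow> 'e measure) \<Rightarrow> ('e \<Rightarrow> 'u) \<Rightarrow> 'e \<Rightarrow> 'e measure" where
  "controlled_kernel P u x = P (u x) x"

primrec kernel_iterate :: "('e::topological_space \<Rightarrow> 'e measure) \<Rightarrow> nat \<Rightarrow> 'e \<Rightarrow> 'e measure" where
  "kernel_iterate K 0 x = return borel x"
| "kernel_iterate K (Suc n) x = kernel_iterate K n x \<bind> K"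

definition natural_filtration ::
  "'w measure \<Rightarrow> (nat \<Rightarrow> 'w \<Rightarrow> 'e::topological_space) \<Rightarrow> nat \<Rightarrow> 'w measure" where
  "natural_filtration M X i =
     sigma (space M) {X j -` B \<inter> space M | j B. j \<le> i \<and> B \<in> sets borel}"

definition markov_process_from ::
  "('e::topological_space \<Rightarrow> 'e measure) \<Rightarrow> 'e \<Rightarrow> 'w measure \<Rightarrow> (nat \<Rightarrow> 'w \<Rightarrow> 'e) \<Rightarrow> bool" where
  "markov_process_from K x M X \<longleftrightarrow>
     prob_space M \<and>
     (\<forall>i. X i \<in> M \<rightarrow>\<^sub>M borel) \<and>
     (AE \<omega> in M. X 0 \<omega> = x) \<and>
     (\<forall>i. \<forall>B\<in>sets borel. AE \<omega> in M.
        real_cond_exp M (natural_filtration M X i) (\<lambda>\<omega>. indicator B (X (Suc i) \<omega>)) \<omega>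
          = measure (K (X i \<omega>)) B)"

(* Extended-real valued because liminf requires a complete lattice.  The term n = 0, where
   1 / 0 = 0, does not affect the lower limit. *)
definition long_run_average ::
  "'w measure \<Rightarrow> (nat \<Rightarrow> 'w \<Rightarrow> 'e) \<Rightarrow> ('e \<times> 'u \<Rightarrow> real) \<Rightarrow> ('e \<Rightarrow> 'u) \<Rightarrow> ereal" where
  "long_run_average M X c u =
     liminf (\<lambda>n. ereal (1 / real n * (\<integral>\<omega>. (\<Sum>i<n. c (X i \<omega>, u (X i \<omega>))) \<partial>M)))"

end

theory Submission
  imports Defs
begin

text \<open>
  Integrating the ergodicity bound against an initial law \<open>\<mu>\<close> gives that \<open>\<mu> (P\<^sup>u)\<^sup>m\<close> is within \<open>\<Delta>\<^sup>m\<close>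
  of \<open>\<pi>\<^sup>u\<close> in variation, uniformly in \<open>u\<close>. Starting the \<open>n\<close>-th chain from the limit law \<open>\<pi>\<close>, it
  therefore suffices that \<open>\<pi> (P\<^sub>n)\<^sup>m\<close> converges to \<open>\<pi>\<close> for each fixed \<open>m\<close>; since \<open>\<pi>\<close> is invariant
  for the limit kernel and kernels contract the distance, this reduces to \<open>m = 1\<close>, which is dominated
  convergence. The cost functionals equal integrals against the invariant laws because the geometric
  bound makes the sum of the deviations of the one-step expectations bounded.
\<close>

section \<open>The distance \<open>sup_dist\<close> between probability measures\<close>

lemma sup_dist_bdd_above:
  assumes "prob_space \<mu>" "prob_space \<nu>"
  shows "bdd_above ((\<lambda>B. \<bar>measure \<mu> B - measure \<nu> B\<bar>) ` sets borel)"
proof (rule bdd_aboveI2)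
  fix B
  show "\<bar>measure \<mu> B - measure \<nu> B\<bar> \<le> 1"
    using prob_space.prob_le_1[OF assms(1), of B] prob_space.prob_le_1[OF assms(2), of B]
      measure_nonneg[of \<mu> B] measure_nonneg[of \<nu> B] by linarith
qed

lemma measure_diff_le_sup_dist:
  assumes "prob_space \<mu>" "prob_space \<nu>" "B \<in> sets borel"
  shows "\<bar>measure \<mu> B - measure \<nu> B\<bar> \<le> sup_dist \<mu> \<nu>"
  unfolding sup_dist_def by (rule cSUP_upper[OF assms(3) sup_dist_bdd_above[OF assms(1,2)]])

lemma sup_dist_le:
  assumes "\<And>B. B \<in> sets borel \<Longrightarrow> \<bar>measure \<mu> B - measure \<nu> B\<bar> \<le> a"
  shows "sup_dist \<mu> \<nu> \<le> a"
  unfolding sup_dist_def by (rule cSUP_least) (use assms in auto)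

lemma sup_dist_nonneg:
  assumes "prob_space \<mu>" "prob_space \<nu>"
  shows "0 \<le> sup_dist \<mu> \<nu>"
  using measure_diff_le_sup_dist[OF assms, of "{}"] by simp

lemma sup_dist_le_1:
  assumes "prob_space \<mu>" "prob_space \<nu>"
  shows "sup_dist \<mu> \<nu> \<le> 1"
proof (rule sup_dist_le)
  fix B
  show "\<bar>measure \<mu> B - measure \<nu> B\<bar> \<le> 1"
    using prob_space.prob_le_1[OF assms(1), of B] prob_space.prob_le_1[OF assms(2), of B]
      measure_nonneg[of \<mu> B] measure_nonneg[of \<nu> B] by linarith
qed

lemma sup_dist_commute: "sup_dist \<mu> \<nu> = sup_dist \<nu> \<mu>"
  unfolding sup_dist_def by (simp add: abs_minus_commute)

lemma sup_dist_triangle: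
  assumes "prob_space \<mu>" "prob_space \<nu>" "prob_space \<rho>"
  shows "sup_dist \<mu> \<rho> \<le> sup_dist \<mu> \<nu> + sup_dist \<nu> \<rho>"
proof (rule sup_dist_le)
  fix B :: "'a set" assume "B \<in> sets borel"
  then show "\<bar>measure \<mu> B - measure \<rho> B\<bar> \<le> sup_dist \<mu> \<nu> + sup_dist \<nu> \<rho>"
    using measure_diff_le_sup_dist[OF assms(1,2), of B] measure_diff_le_sup_dist[OF assms(2,3), of B]
    by linarith
qed

text \<open>The supremum need not be attained, so a maximising set is available only up to a slack
  \<open>e\<close>.\<close>

lemma sup_dist_approx:
  fixes \<mu> \<nu> :: "'a::topological_space measure"
  assumes "prob_space \<mu>" "prob_space \<nu>" "0 < e"
  obtains B where "B \<in> sets borel" "sup_dist \<mu> \<nu> - e < \<bar>measure \<mu> B - measure \<nu> B\<bar>"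
proof -
  have "\<exists>B\<in>sets borel. sup_dist \<mu> \<nu> - e < \<bar>measure \<mu> B - measure \<nu> B\<bar>"
  proof (subst less_cSUP_iff[symmetric])
    show "sup_dist \<mu> \<nu> - e < (SUP B\<in>sets borel. \<bar>measure \<mu> B - measure \<nu> B\<bar>)"
      using assms(3) unfolding sup_dist_def by linarith
  qed (use sup_dist_bdd_above[OF assms(1,2)] in auto)
  then show ?thesis using that by blast
qed

section \<open>Integrals of bounded functions under nearby laws\<close>

lemma (in prob_space) integrable_bounded:
  fixes f :: "'a \<Rightarrow> real"
  assumes "f \<in> borel_measurable M" "\<And>x. \<bar>f x\<bar> \<le> C"
  shows "integrable M f"
  by (rule integrable_const_bound[where B=C]) (use assms in auto)

lemma space_prob_algebra_borelD:
  assumes "\<mu> \<in> space (prob_algebra (borel :: 'a::topological_space measure))"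
  shows "prob_space \<mu>" "sets \<mu> = sets borel" "space \<mu> = UNIV"
    "measurable \<mu> N = measurable borel N"
proof -
  show *: "prob_space \<mu>" "sets \<mu> = sets borel"
    using assms by (auto simp: space_prob_algebra)
  then show "space \<mu> = UNIV" "measurable \<mu> N = measurable borel N"
    using sets_eq_imp_space_eq[of \<mu> borel] by (auto cong: measurable_cong_sets)
qed

text \<open>The sum counts the positive integers not exceeding \<open>r\<close>. Since
  \<open>r\<close> is at most \<open>N\<close>, none of them is cut off and the count is the floor
  of \<open>r\<close>.\<close>

lemma floor_layers:
  fixes r :: real
  assumes "0 \<le> r" "r \<le> real N"
  shows "\<bar>r - (\<Sum>k=1..N. indicator {k. real k \<le> r} k)\<bar> \<le> 1"
proof -
  have "{1..N} \<inter> {k. real k \<le> r} = {1..nat \<lfloor>r\<rfloor>}"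
    using assms by (auto simp: le_nat_floor le_nat_iff le_floor_iff)
  then have "(\<Sum>k=1..N. indicator {k. real k \<le> r} k :: real) = real (nat \<lfloor>r\<rfloor>)"
    by (simp add: sum.inter_restrict[symmetric] indicator_def sum.If_cases)
  then show ?thesis using assms by linarith
qed

text \<open>Approximating \<open>f\<close> by \<open>\<lfloor>N f\<rfloor> / N\<close>, an average of \<open>N\<close> indicators, gives the constant \<open>1\<close>.\<close>

lemma integral_diff_le_sup_dist_unit:
  fixes f :: "'a::topological_space \<Rightarrow> real"
  assumes mu: "\<mu> \<in> space (prob_algebra borel)" and nu: "\<nu> \<in> space (prob_algebra borel)"
    and f[measurable]: "f \<in> borel_measurable borel" and f0: "\<And>x. 0 \<le> f x" and f1: "\<And>x. f x \<le> 1"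
  shows "\<bar>(\<integral>x. f x \<partial>\<mu>) - (\<integral>x. f x \<partial>\<nu>)\<bar> \<le> sup_dist \<mu> \<nu>"
proof -
  define A where "A N k = {x. real k \<le> real N * f x}" for N k :: nat
  define g where "g N x = (\<Sum>k=1..N. indicator (A N k) x :: real)" for N x
  have A: "A N k \<in> sets borel" for N k unfolding A_def by measurable
  have fg: "\<bar>real N * f x - g N x\<bar> \<le> 1" for N x
    using floor_layers[of "real N * f x" N] f0[of x] mult_left_mono[OF f1[of x], of "real N"]
    by (simp add: g_def A_def indicator_def)
  \<comment> \<open>The pointwise error between \<open>N f\<close> and \<open>g N\<close> is at most
    1, hence so is its integral under any law, whatever \<open>N\<close> is.\<close>
  have approx: "\<bar>real N * (\<integral>x. f x \<partial>\<rho>) - (\<Sum>k=1..N. measure \<rho> (A N k))\<bar> \<le> 1"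
    if rho: "\<rho> \<in> space (prob_algebra borel)" for \<rho> N
  proof -
    interpret prob_space \<rho> using space_prob_algebra_borelD[OF rho] by simp
    note [simp] = space_prob_algebra_borelD(2-4)[OF rho]
    have intf: "integrable \<rho> f" by (rule integrable_bounded[where C=1]) (use f f0 f1 in auto)
    have intA: "integrable \<rho> (indicator (A N k) :: 'a \<Rightarrow> real)" for k
      using A by (auto simp: emeasure_eq_measure)
    have intg: "integrable \<rho> (g N)" unfolding g_def using intA by auto
    have "(\<integral>x. g N x \<partial>\<rho>) = (\<Sum>k=1..N. measure \<rho> (A N k))"
      unfolding g_def using intA by (subst Bochner_Integration.integral_sum) auto
    then have "real N * (\<integral>x. f x \<partial>\<rho>) - (\<Sum>k=1..N. measure \<rho> (A N k)) = (\<integral>x. real N * f x - g N x \<partial>\<rho>)"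
      using intf intg by simp
    also have "\<bar>\<dots>\<bar> \<le> (\<integral>x. \<bar>real N * f x - g N x\<bar> \<partial>\<rho>)" by (rule integral_abs_bound)
    also have "\<dots> \<le> (\<integral>x. 1 \<partial>\<rho>)"
      using intf intg fg by (intro integral_mono) auto
    finally show ?thesis using prob_space by simp
  qed
  \<comment> \<open>The 2 collects one approximation error for each measure, while the
    \<open>N\<close> layers contribute at most \<open>N\<close> times the distance. Dividing by
    \<open>N = Suc n\<close>, which is never zero, leaves an error that vanishes with
    \<open>n\<close>.\<close>
  have main: "\<bar>(\<integral>x. f x \<partial>\<mu>) - (\<integral>x. f x \<partial>\<nu>)\<bar> \<le> sup_dist \<mu> \<nu> + 2 * inverse (real (Suc n))" for n
  proof -
    let ?N = "Suc n" let ?I = "(\<integral>x. f x \<partial>\<mu>) - (\<integral>x. f x \<partial>\<nu>)"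
    have "\<bar>(\<Sum>k=1..?N. measure \<mu> (A ?N k)) - (\<Sum>k=1..?N. measure \<nu> (A ?N k))\<bar>
      \<le> (\<Sum>k=1..?N. \<bar>measure \<mu> (A ?N k) - measure \<nu> (A ?N k)\<bar>)"
      unfolding sum_subtractf[symmetric] by (rule sum_abs)
    also have "\<dots> \<le> (\<Sum>k=1..?N. sup_dist \<mu> \<nu>)"
      using measure_diff_le_sup_dist[OF space_prob_algebra_borelD(1)[OF mu] space_prob_algebra_borelD(1)[OF nu] A]
      by (intro sum_mono) auto
    also have "\<dots> = real ?N * sup_dist \<mu> \<nu>" by simp
    finally have "\<bar>real ?N * (\<integral>x. f x \<partial>\<mu>) - real ?N * (\<integral>x. f x \<partial>\<nu>)\<bar> \<le> real ?N * sup_dist \<mu> \<nu> + 2"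
      using approx[OF mu, of ?N] approx[OF nu, of ?N] by linarith
    then have "real ?N * \<bar>?I\<bar> \<le> real ?N * (sup_dist \<mu> \<nu> + 2 * inverse (real ?N))"
      by (simp add: abs_mult right_diff_distrib[symmetric] distrib_left right_inverse_eq
          mult.left_commute[of _ 2] del: of_nat_Suc)
    then show ?thesis by (rule mult_left_le_imp_le) simp
  qed
  have "(\<lambda>n. sup_dist \<mu> \<nu> + 2 * inverse (real (Suc n))) \<longlonglongrightarrow> sup_dist \<mu> \<nu> + 2 * 0"
    by (intro tendsto_intros LIMSEQ_inverse_real_of_nat)
  from LIMSEQ_le_const[OF this] show ?thesis using main by auto
qed

text \<open>The affine map \<open>(f + C) / (2 * C)\<close> brings \<open>f\<close> into the unit
  interval, and undoing it costs the factor \<open>2 * C\<close>. The case \<open>C = 0\<close> is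
  split off because of the division.\<close>

lemma integral_diff_le_sup_dist:
  fixes f :: "'a::topological_space \<Rightarrow> real"
  assumes mu: "\<mu> \<in> space (prob_algebra borel)" and nu: "\<nu> \<in> space (prob_algebra borel)"
    and f[measurable]: "f \<in> borel_measurable borel" and fC: "\<And>x. \<bar>f x\<bar> \<le> C"
  shows "\<bar>(\<integral>x. f x \<partial>\<mu>) - (\<integral>x. f x \<partial>\<nu>)\<bar> \<le> 2 * C * sup_dist \<mu> \<nu>"
proof (cases "C = 0")
  case True
  then show ?thesis using fC by simp
next
  case False
  then have C: "C > 0" using fC[of undefined] by linarith
  have norm: "(\<integral>x. (f x + C) / (2 * C) \<partial>\<rho>) = ((\<integral>x. f x \<partial>\<rho>) + C) / (2 * C)"
    if rho: "\<rho> \<in> space (prob_algebra borel)" for \<rho>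
  proof -
    interpret prob_space \<rho> using space_prob_algebra_borelD[OF rho] by simp
    note [simp] = space_prob_algebra_borelD(2-4)[OF rho]
    have "integrable \<rho> f" by (rule integrable_bounded[OF _ fC]) simp
    then show ?thesis using prob_space by simp
  qed
  have "\<bar>(\<integral>x. (f x + C) / (2 * C) \<partial>\<mu>) - (\<integral>x. (f x + C) / (2 * C) \<partial>\<nu>)\<bar> \<le> sup_dist \<mu> \<nu>"
  proof (rule integral_diff_le_sup_dist_unit[OF mu nu])
    fix x show "0 \<le> (f x + C) / (2 * C)" "(f x + C) / (2 * C) \<le> 1"
      using fC[of x] C by (auto simp: field_simps abs_le_iff)
  qed simp
  then show ?thesis
    unfolding norm[OF mu] norm[OF nu] using C by (simp add: diff_divide_distrib[symmetric] field_simps)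
qed

section \<open>Kernels acting on laws\<close>

lemma bind_in_space_prob_algebra:
  assumes "\<mu> \<in> space (prob_algebra M)" "K \<in> M \<rightarrow>\<^sub>M prob_algebra N"
  shows "\<mu> \<bind> K \<in> space (prob_algebra N)"
  using prob_space_bind'[OF assms] sets_bind'[OF assms] by (simp add: space_prob_algebra)

lemma markov_kernel_space:
  "markov_kernel K \<Longrightarrow> K x \<in> space (prob_algebra borel)"
  by (rule measurable_space[of K borel]) auto

lemma measure_bind_markov_kernel:
  assumes mu: "\<mu> \<in> space (prob_algebra borel)" and K: "markov_kernel K" and B: "B \<in> sets borel"
  shows "measure (\<mu> \<bind> K) B = (\<integral>x. measure (K x) B \<partial>\<mu>)"
proof -
  interpret prob_space \<mu> using space_prob_algebra_borelD[OF mu] by simp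
  show ?thesis
    by (rule measure_bind[OF _ B])
      (use measurable_prob_algebraD[OF K] space_prob_algebra_borelD(4)[OF mu] in auto)
qed

lemma borel_measurable_measure_markov_kernel:
  assumes "markov_kernel K" "B \<in> sets borel"
  shows "(\<lambda>x. measure (K x) B) \<in> borel_measurable borel"
  using assms by measurable

text \<open>For fixed \<open>B\<close> the function \<open>\<lambda>x. measure (K x) B\<close> takes
  values in the unit interval, so the bound for such integrands applies, uniformly in
  \<open>B\<close>: a Markov kernel is a contraction.\<close>

lemma sup_dist_bind_le:
  fixes \<mu> :: "'a::topological_space measure"
  assumes mu: "\<mu> \<in> space (prob_algebra borel)" and nu: "\<nu> \<in> space (prob_algebra borel)"
    and K: "markov_kernel K"
  shows "sup_dist (\<mu> \<bind> K) (\<nu> \<bind> K) \<le> sup_dist \<mu> \<nu>"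
proof (rule sup_dist_le)
  fix B :: "'a set" assume B: "B \<in> sets borel"
  note prob = space_prob_algebra_borelD(1)[OF markov_kernel_space[OF K]]
  show "\<bar>measure (\<mu> \<bind> K) B - measure (\<nu> \<bind> K) B\<bar> \<le> sup_dist \<mu> \<nu>"
    unfolding measure_bind_markov_kernel[OF mu K B] measure_bind_markov_kernel[OF nu K B]
    by (rule integral_diff_le_sup_dist_unit[OF mu nu borel_measurable_measure_markov_kernel[OF K B]])
      (auto intro: prob_space.prob_le_1[OF prob])
qed

text \<open>Transfers a bound that is uniform over point starts to an arbitrary initial law: \<mu>
  \<bind> K is a mixture of the laws \<open>K x\<close>, and averaging the differences over \<mu>
  keeps the bound \<open>d\<close>.\<close>

lemma sup_dist_bind_const_le:
  fixes \<mu> :: "'a::topological_space measure"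
  assumes mu: "\<mu> \<in> space (prob_algebra borel)" and nu: "prob_space \<nu>"
    and K: "markov_kernel K" and d: "\<And>x. sup_dist (K x) \<nu> \<le> d"
  shows "sup_dist (\<mu> \<bind> K) \<nu> \<le> d"
proof (rule sup_dist_le)
  fix B :: "'a set" assume B: "B \<in> sets borel"
  interpret prob_space \<mu> using space_prob_algebra_borelD[OF mu] by simp
  note [simp] = space_prob_algebra_borelD(2-4)[OF mu]
  note prob = space_prob_algebra_borelD(1)[OF markov_kernel_space[OF K]]
  have int: "integrable \<mu> (\<lambda>x. measure (K x) B)"
    by (rule integrable_bounded[where C=1])
      (use borel_measurable_measure_markov_kernel[OF K B] prob_space.prob_le_1[OF prob] in auto)
  have "\<bar>measure (\<mu> \<bind> K) B - measure \<nu> B\<bar> = \<bar>\<integral>x. measure (K x) B - measure \<nu> B \<partial>\<mu>\<bar>"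
    using int prob_space by (simp add: measure_bind_markov_kernel[OF mu K B])
  also have "\<dots> \<le> (\<integral>x. \<bar>measure (K x) B - measure \<nu> B\<bar> \<partial>\<mu>)" by (rule integral_abs_bound)
  also have "\<dots> \<le> (\<integral>x. d \<partial>\<mu>)"
    using int measure_diff_le_sup_dist[OF prob nu B] d
    by (intro integral_mono) (auto intro: order_trans)
  finally show "\<bar>measure (\<mu> \<bind> K) B - measure \<nu> B\<bar> \<le> d" using prob_space by simp
qed

text \<open>The integrand \<open>\<lambda>x. sup_dist (K n x) (L x)\<close> need not be measurable; choosing a nearly maximising
  set for each \<open>n\<close> before integrating makes dominated convergence applicable.\<close>

lemma sup_dist_bind_tendsto:
  fixes \<mu> :: "'a::topological_space measure"
  assumes mu: "\<mu> \<in> space (prob_algebra borel)"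
    and K: "\<And>n. markov_kernel (K n)" and L: "markov_kernel L"
    and lim: "\<And>x. (\<lambda>n. sup_dist (K n x) (L x)) \<longlonglongrightarrow> 0"
  shows "(\<lambda>n. sup_dist (\<mu> \<bind> K n) (\<mu> \<bind> L)) \<longlonglongrightarrow> 0"
proof -
  interpret prob_space \<mu> using space_prob_algebra_borelD[OF mu] by simp
  note [simp] = space_prob_algebra_borelD(2-4)[OF mu]
  note pK = space_prob_algebra_borelD(1)[OF markov_kernel_space[OF K]]
  note pL = space_prob_algebra_borelD(1)[OF markov_kernel_space[OF L]]
  note pbK = space_prob_algebra_borelD(1)[OF bind_in_space_prob_algebra[OF mu K]]
  note pbL = space_prob_algebra_borelD(1)[OF bind_in_space_prob_algebra[OF mu L]]
  have "\<exists>B. B \<in> sets borel \<and> sup_dist (\<mu> \<bind> K n) (\<mu> \<bind> L) - inverse (real (Suc n))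
      < \<bar>measure (\<mu> \<bind> K n) B - measure (\<mu> \<bind> L) B\<bar>" for n
    by (rule sup_dist_approx[OF pbK pbL, of "inverse (real (Suc n))" n]) auto
  then obtain B where B: "\<And>n. B n \<in> sets borel" and near:
    "\<And>n. sup_dist (\<mu> \<bind> K n) (\<mu> \<bind> L) - inverse (real (Suc n))
      < \<bar>measure (\<mu> \<bind> K n) (B n) - measure (\<mu> \<bind> L) (B n)\<bar>"
    by metis
  define h where "h n x = measure (K n x) (B n) - measure (L x) (B n)" for n x
  have hd: "\<bar>h n x\<bar> \<le> sup_dist (K n x) (L x)" for n x
    unfolding h_def by (rule measure_diff_le_sup_dist[OF pK pL B])
  note meas = borel_measurable_measure_markov_kernel[OF K B] borel_measurable_measure_markov_kernel[OF L B]
  have h_eq: "(\<integral>x. h n x \<partial>\<mu>) = measure (\<mu> \<bind> K n) (B n) - measure (\<mu> \<bind> L) (B n)" for n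
    unfolding h_def measure_bind_markov_kernel[OF mu K B] measure_bind_markov_kernel[OF mu L B]
    by (intro Bochner_Integration.integral_diff integrable_bounded[where C=1])
      (use meas prob_space.prob_le_1[OF pK] prob_space.prob_le_1[OF pL] in auto)
  have "(\<lambda>n. \<integral>x. h n x \<partial>\<mu>) \<longlonglongrightarrow> (\<integral>x. 0 \<partial>\<mu>)"
  proof (rule integral_dominated_convergence[where w="\<lambda>_. 1"])
    show "AE x in \<mu>. (\<lambda>n. h n x) \<longlonglongrightarrow> 0"
      using hd by (intro AE_I2 Lim_null_comparison[OF always_eventually lim]) auto
    show "AE x in \<mu>. norm (h n x) \<le> 1" for n
      using order_trans[OF hd sup_dist_le_1[OF pK pL]] by auto
  qed (use meas in \<open>auto simp: h_def\<close>)
  \<comment> \<open>By the choice of \<open>B n\<close>, this sequence dominates the distance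
    between the two laws after one step.\<close>
  then have "(\<lambda>n. \<bar>\<integral>x. h n x \<partial>\<mu>\<bar> + inverse (real (Suc n))) \<longlonglongrightarrow> 0"
    using tendsto_add[OF tendsto_rabs_zero LIMSEQ_inverse_real_of_nat] by force
  then show ?thesis
  proof (rule Lim_null_comparison[rotated])
    show "\<forall>\<^sub>F n in sequentially. norm (sup_dist (\<mu> \<bind> K n) (\<mu> \<bind> L))
      \<le> \<bar>\<integral>x. h n x \<partial>\<mu>\<bar> + inverse (real (Suc n))"
      using near sup_dist_nonneg[OF pbK pbL] unfolding h_eq
      by (intro always_eventually allI) (smt (verit) real_norm_def)
  qed
qed

section \<open>Iterated kernels and stability of the invariant law\<close>

lemma markov_kernel_iterate:
  assumes K: "markov_kernel K"
  shows "markov_kernel (kernel_iterate K n)"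
proof (induction n)
  case 0
  have "kernel_iterate K 0 = return borel" by (rule ext) simp
  then show ?case by simp
next
  case (Suc n)
  have "kernel_iterate K (Suc n) = (\<lambda>x. kernel_iterate K n x \<bind> K)" by (rule ext) simp
  then show ?case using measurable_bind_prob_space[OF Suc K] by simp
qed

text \<open>Associativity of \<bind> lets the last step be split off for any initial law, which is
  the form needed for induction on the number of steps.\<close>

lemma bind_kernel_iterate_Suc:
  assumes mu: "\<mu> \<in> space (prob_algebra borel)" and K: "markov_kernel K"
  shows "\<mu> \<bind> kernel_iterate K (Suc n) = (\<mu> \<bind> kernel_iterate K n) \<bind> K"
proof -
  have "kernel_iterate K (Suc n) = (\<lambda>x. kernel_iterate K n x \<bind> K)" by (rule ext) simp
  then show ?thesis
    using bind_assoc[of "kernel_iterate K n" \<mu> borel K borel]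
      measurable_prob_algebraD[OF markov_kernel_iterate[OF K]] measurable_prob_algebraD[OF K]
    by (simp add: space_prob_algebra_borelD(4)[OF mu])
qed

text \<open>Along one arbitrary starting point, successive iterates both approach \<open>p\<close>,
  and \<open>K\<close> maps each to the next. Contraction then forces \<open>p \<bind> K\<close> and
  \<open>p\<close> together. Invariance is expressed as distance zero, which is what the triangle
  inequality uses later.\<close>

lemma sup_dist_bind_invariant:
  fixes K :: "'a::topological_space \<Rightarrow> 'a measure"
  assumes K: "markov_kernel K" and p: "p \<in> space (prob_algebra borel)"
    and D: "0 \<le> D" "D < 1"
    and erg: "\<And>x n. n \<ge> 1 \<Longrightarrow> sup_dist (kernel_iterate K n x) p \<le> D ^ n"
  shows "sup_dist (p \<bind> K) p = 0"
proof -
  fix x :: 'a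
  let ?q = "\<lambda>n. kernel_iterate K n x"
  have q: "?q n \<in> space (prob_algebra borel)" for n
    by (rule markov_kernel_space[OF markov_kernel_iterate[OF K]])
  note pr = space_prob_algebra_borelD(1)
  note pK = bind_in_space_prob_algebra[OF p K]
  \<comment> \<open>The iterates start at \<open>Suc n\<close> because the geometric bound is
    assumed only from the first step on.\<close>
  have "sup_dist (p \<bind> K) p \<le> D ^ Suc n + D ^ Suc (Suc n)" for n
  proof -
    have "sup_dist (p \<bind> K) p \<le> sup_dist (p \<bind> K) (?q (Suc (Suc n))) + sup_dist (?q (Suc (Suc n))) p"
      by (rule sup_dist_triangle[OF pr[OF pK] pr[OF q] pr[OF p]])
    also have "sup_dist (p \<bind> K) (?q (Suc (Suc n))) \<le> sup_dist p (?q (Suc n))"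
      using sup_dist_bind_le[OF p q K, of "Suc n"] by simp
    also have "\<dots> \<le> D ^ Suc n" using erg[of "Suc n" x] by (simp add: sup_dist_commute)
    also have "sup_dist (?q (Suc (Suc n))) p \<le> D ^ Suc (Suc n)" by (rule erg) simp
    finally show ?thesis by simp
  qed
  moreover have "(\<lambda>n. D ^ Suc n + D ^ Suc (Suc n)) \<longlonglongrightarrow> 0 + 0"
    using D by (intro tendsto_add LIMSEQ_Suc[OF LIMSEQ_power_zero]
        LIMSEQ_Suc[OF LIMSEQ_Suc[OF LIMSEQ_power_zero]]) auto
  ultimately have "sup_dist (p \<bind> K) p \<le> 0" by (auto intro: LIMSEQ_le_const)
  then show ?thesis using sup_dist_nonneg[OF pr[OF pK] pr[OF p]] by simp
qed

text \<open>The rate \<open>D\<close> is common to all \<open>n\<close>. Hence the number of steps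
  \<open>m\<close> can be fixed first, making \<open>D ^ m\<close> small for every chain at once,
  and only then does \<open>n\<close> tend to infinity.\<close>

lemma sup_dist_invariant_tendsto:
  fixes K :: "nat \<Rightarrow> 'a::topological_space \<Rightarrow> 'a measure"
  assumes K: "\<And>n. markov_kernel (K n)" and L: "markov_kernel L"
    and p: "\<And>n. p n \<in> space (prob_algebra borel)" and q: "q \<in> space (prob_algebra borel)"
    and D: "0 \<le> D" "D < 1"
    and ergK: "\<And>n x m. m \<ge> 1 \<Longrightarrow> sup_dist (kernel_iterate (K n) m x) (p n) \<le> D ^ m"
    and ergL: "\<And>x m. m \<ge> 1 \<Longrightarrow> sup_dist (kernel_iterate L m x) q \<le> D ^ m"
    and lim: "\<And>x. (\<lambda>n. sup_dist (K n x) (L x)) \<longlonglongrightarrow> 0"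
  shows "(\<lambda>n. sup_dist (p n) q) \<longlonglongrightarrow> 0"
proof -
  note pr = space_prob_algebra_borelD(1)
  define r where "r m n = q \<bind> kernel_iterate (K n) m" for m n
  have r: "r m n \<in> space (prob_algebra borel)" for m n
    unfolding r_def by (rule bind_in_space_prob_algebra[OF q markov_kernel_iterate[OF K]])
  note qK = bind_in_space_prob_algebra[OF q K]
  note qL = bind_in_space_prob_algebra[OF q L]
  have step: "(\<lambda>n. sup_dist (q \<bind> K n) (q \<bind> L)) \<longlonglongrightarrow> 0"
    by (rule sup_dist_bind_tendsto[OF q K L lim])
  have rlim: "(\<lambda>n. sup_dist (r m n) q) \<longlonglongrightarrow> 0" for m
  proof (induction m)
    case 0
    have "r 0 n = q" for n
    proof -
      \<comment> \<open>The zeroth iterate is \<open>return borel\<close>, while the unit law for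
        \<bind> needs \<open>return q\<close>; they agree because \<open>q\<close> has the Borel
        sets.\<close>
      have "kernel_iterate (K n) 0 = return q"
        by (rule ext) (simp add: return_cong[OF space_prob_algebra_borelD(2)[OF q]])
      then show ?thesis unfolding r_def by (simp add: bind_return')
    qed
    moreover have "sup_dist q q = 0" using sup_dist_le[of q q 0] sup_dist_nonneg[OF pr[OF q] pr[OF q]] by simp
    ultimately show ?case by simp
  next
    case (Suc m)
    \<comment> \<open>Inserting \<open>q \<bind> K n\<close> and \<open>q \<bind> L\<close>
      separates three effects: contraction of the error after \<open>m\<close> steps, the one-step
      perturbation at \<open>q\<close>, and the invariance of \<open>q\<close> under
      \<open>L\<close>.\<close>
    have bound: "sup_dist (r (Suc m) n) q \<le> sup_dist (r m n) q + sup_dist (q \<bind> K n) (q \<bind> L)" for n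
    proof -
      have "sup_dist (r (Suc m) n) q \<le> sup_dist (r (Suc m) n) (q \<bind> K n) + sup_dist (q \<bind> K n) q"
        by (rule sup_dist_triangle[OF pr[OF r] pr[OF qK] pr[OF q]])
      also have "sup_dist (r (Suc m) n) (q \<bind> K n) \<le> sup_dist (r m n) q"
        using sup_dist_bind_le[OF r q K, of m n n] bind_kernel_iterate_Suc[OF q K, of n m]
        by (simp add: r_def)
      also have "sup_dist (q \<bind> K n) q \<le> sup_dist (q \<bind> K n) (q \<bind> L) + sup_dist (q \<bind> L) q"
        by (rule sup_dist_triangle[OF pr[OF qK] pr[OF qL] pr[OF q]])
      also have "sup_dist (q \<bind> L) q = 0"
        by (rule sup_dist_bind_invariant[OF L q D ergL])
      finally show ?thesis by simp
    qed
    show ?case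
      by (rule Lim_null_comparison[OF _ tendsto_add_zero[OF Suc step]])
        (use bound sup_dist_nonneg[OF pr[OF r] pr[OF q]] in auto)
  qed
  have bound: "sup_dist (p n) q \<le> D ^ m + sup_dist (r m n) q" if "m \<ge> 1" for m n
  proof -
    have "sup_dist (p n) q \<le> sup_dist (p n) (r m n) + sup_dist (r m n) q"
      by (rule sup_dist_triangle[OF pr[OF p] pr[OF r] pr[OF q]])
    moreover have "sup_dist (r m n) (p n) \<le> D ^ m"
      unfolding r_def
      by (rule sup_dist_bind_const_le[OF q pr[OF p] markov_kernel_iterate[OF K] ergK[OF that]])
    ultimately show ?thesis by (simp add: sup_dist_commute)
  qed
  show ?thesis
  proof (rule LIMSEQ_I)
    fix e :: real assume e: "0 < e"
    have "(\<lambda>m. D ^ m) \<longlonglongrightarrow> 0" using D by (intro LIMSEQ_power_zero) auto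
    then have "\<forall>\<^sub>F m in sequentially. D ^ m < e / 2 \<and> m \<ge> 1"
      using e by (intro eventually_conj order_tendstoD(2)[where y=0] eventually_ge_at_top) auto
    then obtain m where m: "D ^ m < e / 2" "m \<ge> 1" by (auto simp: eventually_sequentially)
    have "\<forall>\<^sub>F n in sequentially. sup_dist (r m n) q < e / 2"
      using e by (intro order_tendstoD(2)[OF rlim]) auto
    then have "\<forall>\<^sub>F n in sequentially. norm (sup_dist (p n) q - 0) < e"
    proof eventually_elim
      case (elim n)
      then show ?case using bound[OF m(2), of n] m(1) sup_dist_nonneg[OF pr[OF p] pr[OF q], of n] by simp
    qed
    then show "\<exists>N. \<forall>n\<ge>N. norm (sup_dist (p n) q - 0) < e" by (simp add: eventually_sequentially)
  qed
qed

text \<open>Replacing \<open>p n\<close> by \<open>q\<close> costs at most \<open>2 * C\<close>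
  times their distance, since \<open>C\<close> bounds all \<open>g n\<close> at once. Under the
  fixed law \<open>q\<close>, dominated convergence handles the integrands.\<close>

lemma integral_tendsto_of_sup_dist:
  fixes g :: "nat \<Rightarrow> 'a::topological_space \<Rightarrow> real"
  assumes p: "\<And>n. p n \<in> space (prob_algebra borel)" and q: "q \<in> space (prob_algebra borel)"
    and pq: "(\<lambda>n. sup_dist (p n) q) \<longlonglongrightarrow> 0"
    and g: "\<And>n. g n \<in> borel_measurable borel" "\<And>n x. \<bar>g n x\<bar> \<le> C"
    and h: "h \<in> borel_measurable borel" and lim: "\<And>x. (\<lambda>n. g n x) \<longlonglongrightarrow> h x"
  shows "(\<lambda>n. \<integral>x. g n x \<partial>p n) \<longlonglongrightarrow> (\<integral>x. h x \<partial>q)"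
proof -
  interpret prob_space q using space_prob_algebra_borelD[OF q] by simp
  note [simp] = space_prob_algebra_borelD(2-4)[OF q]
  have "(\<lambda>n. \<integral>x. g n x \<partial>q) \<longlonglongrightarrow> (\<integral>x. h x \<partial>q)"
    by (rule integral_dominated_convergence[where w="\<lambda>_. C"]) (use g h lim in auto)
  moreover have "(\<lambda>n. (\<integral>x. g n x \<partial>p n) - (\<integral>x. g n x \<partial>q)) \<longlonglongrightarrow> 0"
    by (rule Lim_null_comparison[OF _ tendsto_mult_right_zero[OF pq, of "2 * C"]])
      (use integral_diff_le_sup_dist[OF p q g] in auto)
  ultimately show ?thesis using tendsto_add by fastforce
qed

section \<open>Laws of the process and long run averages\<close>

text \<open>Taking expectations in the Markov property turns it into the recursion that defines the
  iterated kernel.\<close>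

lemma distr_markov_process:
  fixes X :: "nat \<Rightarrow> 'w \<Rightarrow> 'e::topological_space"
  assumes proc: "markov_process_from K x M X" and K: "markov_kernel K"
  shows "distr M borel (X i) = kernel_iterate K i x"
proof -
  interpret M: prob_space M using proc by (simp add: markov_process_from_def)
  have X[measurable]: "X i \<in> M \<rightarrow>\<^sub>M borel" for i using proc by (simp add: markov_process_from_def)
  have law: "distr M borel (X i) \<in> space (prob_algebra borel)" for i
    using M.prob_space_distr[OF X] by (simp add: space_prob_algebra)
  show ?thesis
  proof (induction i)
    case 0
    have "AE \<omega> in M. X 0 \<omega> = x" using proc by (simp add: markov_process_from_def)
    then have "distr M borel (X 0) = distr M borel (\<lambda>_. x)"
      by (intro distr_cong_AE) auto
    then show ?case by (simp add: M.distr_const)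
  next
    case (Suc i)
    let ?F = "natural_filtration M X i"
    have gen: "{X j -` B \<inter> space M |j B. j \<le> i \<and> B \<in> sets borel} \<subseteq> sets M"
      using measurable_sets[OF X] by auto
    \<comment> \<open>This makes \<open>real_cond_exp\<close> a genuine conditional expectation, so
      that its integral is that of the indicator.\<close>
    have "subalgebra M ?F"
      unfolding subalgebra_def natural_filtration_def
      using gen sets.sigma_sets_subset[OF gen] sets.sets_into_space
      by (simp add: space_measure_of_conv sets_measure_of_conv)
    then interpret finite_measure_subalgebra M ?F by unfold_locales
    show ?case
    proof (rule measure_eqI)
      show "sets (distr M borel (X (Suc i))) = sets (kernel_iterate K (Suc i) x)"
        by (simp add: space_prob_algebra_borelD(2)[OF markov_kernel_space[OF markov_kernel_iterate[OF K]], of "Suc i" x]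
            del: kernel_iterate.simps)
    next
      fix B :: "'e set" assume "B \<in> sets (distr M borel (X (Suc i)))"
      then have B[measurable]: "B \<in> sets borel" by simp
      have "measure (distr M borel (X (Suc i))) B = (\<integral>\<omega>. indicator B (X (Suc i) \<omega>) \<partial>M)"
        by (simp add: integral_distr[OF X, symmetric])
      also have "\<dots> = (\<integral>\<omega>. real_cond_exp M ?F (\<lambda>\<omega>. indicator B (X (Suc i) \<omega>)) \<omega> \<partial>M)"
        by (rule real_cond_exp_int(2)[symmetric], rule M.integrable_bounded[where C=1])
          (auto simp: indicator_def)
      \<comment> \<open>The Markov property holds almost everywhere for each fixed \<open>B\<close>,
        which is enough under the integral.\<close>
      also have "\<dots> = (\<integral>\<omega>. measure (K (X i \<omega>)) B \<partial>M)"
        using proc B borel_measurable_measure_markov_kernel[OF K B]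
        by (intro integral_cong_AE) (auto simp: markov_process_from_def)
      also have "\<dots> = (\<integral>y. measure (K y) B \<partial>distr M borel (X i))"
        by (rule integral_distr[symmetric]) (use borel_measurable_measure_markov_kernel[OF K B] in auto)
      also have "\<dots> = measure (distr M borel (X i) \<bind> K) B"
        by (rule measure_bind_markov_kernel[OF law K B, symmetric])
      finally have "measure (distr M borel (X (Suc i))) B = measure (kernel_iterate K (Suc i) x) B"
        by (simp add: Suc)
      then show "emeasure (distr M borel (X (Suc i))) B = emeasure (kernel_iterate K (Suc i) x) B"
        using prob_space.finite_measure[THEN finite_measure.emeasure_eq_measure]
          space_prob_algebra_borelD(1)[OF law]
          space_prob_algebra_borelD(1)[OF markov_kernel_space[OF markov_kernel_iterate[OF K]]]
        by metis
    qed
  qed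
qed

text \<open>The deviations from \<open>l\<close> sum to at most \<open>C / (1 - D)\<close>, so the
  mean of the first \<open>n\<close> terms is off by at most that constant over
  \<open>n\<close>.\<close>

lemma Cesaro_mean_tendsto_of_geometric:
  fixes a :: "nat \<Rightarrow> real"
  assumes D: "0 \<le> D" "D < 1" and a: "\<And>i. \<bar>a i - l\<bar> \<le> C * D ^ i"
  shows "(\<lambda>n. 1 / real n * (\<Sum>i<n. a i)) \<longlonglongrightarrow> l"
proof -
  have C: "0 \<le> C" using a[of 0] by simp
  have sumD: "(\<Sum>i<n. D ^ i) \<le> 1 / (1 - D)" for n
    using D by (auto simp: sum_gp_strict divide_right_mono)
  \<comment> \<open>At \<open>n = 0\<close> the mean is 0 by the convention for division, and the
    bound would force \<open>l = 0\<close>.\<close>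
  have "\<bar>1 / real n * (\<Sum>i<n. a i) - l\<bar> \<le> C / (1 - D) * (1 / real n)" if n: "n \<ge> 1" for n
  proof -
    have "\<bar>\<Sum>i<n. a i - l\<bar> \<le> (\<Sum>i<n. C * D ^ i)"
      by (rule order_trans[OF sum_abs sum_mono]) (rule a)
    also have "\<dots> = C * (\<Sum>i<n. D ^ i)" by (simp add: sum_distrib_left)
    also have "\<dots> \<le> C / (1 - D)" using mult_left_mono[OF sumD C] by simp
    finally have "\<bar>(\<Sum>i<n. a i) - real n * l\<bar> / real n \<le> C / (1 - D) / real n"
      by (intro divide_right_mono) (simp_all add: sum_subtractf)
    moreover have "1 / real n * (\<Sum>i<n. a i) - l = ((\<Sum>i<n. a i) - real n * l) / real n"
      using n by (simp add: field_simps)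
    ultimately show ?thesis by simp
  qed
  then have "(\<lambda>n. 1 / real n * (\<Sum>i<n. a i) - l) \<longlonglongrightarrow> 0"
    by (intro Lim_null_comparison[OF _ tendsto_mult_right_zero[OF lim_1_over_n, of "C / (1 - D)"]])
      (auto intro!: eventually_sequentiallyI[of 1])
  then show ?thesis by (simp add: LIM_zero_iff)
qed

text \<open>The expected cost at time \<open>i\<close> is within \<open>2 * C * D ^ i\<close> of the
  integral under \<open>p\<close>. The averages therefore converge, and the lower limit is their
  limit.\<close>

lemma long_run_average_eq_integral:
  fixes X :: "nat \<Rightarrow> 'w \<Rightarrow> 'e::topological_space" and c :: "'e \<times> 'u \<Rightarrow> real"
  assumes proc: "markov_process_from K x M X" and K: "markov_kernel K"
    and p: "p \<in> space (prob_algebra borel)" and D: "0 \<le> D" "D < 1"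
    and erg: "\<And>n. n \<ge> 1 \<Longrightarrow> sup_dist (kernel_iterate K n x) p \<le> D ^ n"
    and g: "(\<lambda>y. c (y, v y)) \<in> borel_measurable borel" "\<And>y. \<bar>c (y, v y)\<bar> \<le> C"
  shows "long_run_average M X c v = ereal (\<integral>y. c (y, v y) \<partial>p)"
proof -
  define f where "f y = c (y, v y)" for y
  have f: "f \<in> borel_measurable borel" "\<And>y. \<bar>f y\<bar> \<le> C" using g by (auto simp: f_def[abs_def])
  interpret M: prob_space M using proc by (simp add: markov_process_from_def)
  have X[measurable]: "X i \<in> M \<rightarrow>\<^sub>M borel" for i using proc by (simp add: markov_process_from_def)
  let ?q = "\<lambda>i. kernel_iterate K i x"
  note q = markov_kernel_space[OF markov_kernel_iterate[OF K]]
  have C: "0 \<le> C" using f(2)[of x] by simp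
  have exp: "(\<integral>\<omega>. f (X i \<omega>) \<partial>M) = (\<integral>y. f y \<partial>?q i)" for i
    using integral_distr[OF X f(1), of i] by (simp add: distr_markov_process[OF proc K])
  have int: "integrable M (\<lambda>\<omega>. f (X i \<omega>))" for i
    by (rule M.integrable_bounded[where C=C]) (use f in auto)
  have "\<bar>(\<integral>y. f y \<partial>?q i) - (\<integral>y. f y \<partial>p)\<bar> \<le> 2 * C * D ^ i" for i
  proof -
    \<comment> \<open>Time 0 lies outside the ergodicity bound; there \<open>D ^ 0 = 1\<close>
      bounds any distance between probability measures.\<close>
    have "sup_dist (?q i) p \<le> D ^ i"
      using erg[of i] sup_dist_le_1[OF space_prob_algebra_borelD(1)[OF q] space_prob_algebra_borelD(1)[OF p], of 0]
      by (cases i) auto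
    then show ?thesis
      using integral_diff_le_sup_dist[OF q p f, of i] C
      by (meson order_trans mult_left_mono mult_nonneg_nonneg zero_le_numeral)
  qed
  then have "(\<lambda>n. 1 / real n * (\<Sum>i<n. \<integral>y. f y \<partial>?q i)) \<longlonglongrightarrow> (\<integral>y. f y \<partial>p)"
    by (rule Cesaro_mean_tendsto_of_geometric[OF D])
  then have "(\<lambda>n. ereal (1 / real n * (\<integral>\<omega>. (\<Sum>i<n. f (X i \<omega>)) \<partial>M))) \<longlonglongrightarrow> ereal (\<integral>y. f y \<partial>p)"
    using int by (simp add: Bochner_Integration.integral_sum exp)
  then show ?thesis
    unfolding long_run_average_def f_def[symmetric] by (intro lim_imp_Liminf) auto
qed

section \<open>Continuity of invariant laws and average costs in the control\<close>

theorem theorem1: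
  fixes U :: "'u::topological_space set"
    and \<U> :: "('e::polish_space \<Rightarrow> 'u) set"
    and P :: "'u \<Rightarrow> 'e \<Rightarrow> 'e measure"
    and Pr :: "('e \<Rightarrow> 'u) \<Rightarrow> 'e \<Rightarrow> 'w measure"
    and X :: "('e \<Rightarrow> 'u) \<Rightarrow> nat \<Rightarrow> 'w \<Rightarrow> 'e"
    and \<pi> :: "('e \<Rightarrow> 'u) \<Rightarrow> 'e measure"
    and \<Delta> :: real
    and c :: "'e \<times> 'u \<Rightarrow> real"
    and us :: "nat \<Rightarrow> 'e \<Rightarrow> 'u"
    and u :: "'e \<Rightarrow> 'u"
  assumes "compact U"
    and "\<forall>v\<in>\<U>. v \<in> borel \<rightarrow>\<^sub>M restrict_space borel U"
    and "\<forall>a\<in>U. markov_kernel (P a)"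
    and "\<forall>v\<in>\<U>. markov_kernel (controlled_kernel P v)"
    and "\<forall>v\<in>\<U>. \<forall>x. markov_process_from (controlled_kernel P v) x (Pr v x) (X v)"
    and "0 \<le> \<Delta>" and "\<Delta> < 1"
    and "\<forall>v\<in>\<U>. prob_space (\<pi> v) \<and> sets (\<pi> v) = sets borel \<and>
           (\<forall>x. \<forall>n\<ge>1. sup_dist (kernel_iterate (controlled_kernel P v) n x) (\<pi> v) \<le> \<Delta> ^ n)"
    and "\<forall>n. us n \<in> \<U>" and "u \<in> \<U>"
    and "\<forall>x. (\<lambda>n. us n x) \<longlonglongrightarrow> u x"
    and "\<forall>x. (\<lambda>n. sup_dist (P (us n x) x) (P (u x) x)) \<longlonglongrightarrow> 0"
    and "c \<in> borel_measurable (borel \<Otimes>\<^sub>M restrict_space borel U)"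
    and "bounded (c ` (UNIV \<times> U))"
    and "\<forall>x. continuous_on U (\<lambda>a. c (x, a))"
  shows "(\<lambda>n. sup_dist (\<pi> (us n)) (\<pi> u)) \<longlonglongrightarrow> 0 \<and>
         (\<forall>x.
           (\<forall>n. long_run_average (Pr (us n) x) (X (us n)) c (us n)
                  = ereal (\<integral>y. c (y, us n y) \<partial>\<pi> (us n))) \<and>
           (\<lambda>n. long_run_average (Pr (us n) x) (X (us n)) c (us n))
              \<longlonglongrightarrow> long_run_average (Pr u x) (X u) c u \<and>
           long_run_average (Pr u x) (X u) c u = ereal (\<integral>y. c (y, u y) \<partial>\<pi> u))"
proof -
  let ?K = "controlled_kernel P"
  note K = assms(4)[rule_format] and proc = assms(5)[rule_format]
  note D = assms(6,7) and us = assms(9)[rule_format] and u = assms(10)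
  have p: "\<pi> v \<in> space (prob_algebra borel)" if "v \<in> \<U>" for v
    using assms(8) that by (simp add: space_prob_algebra)
  have erg: "sup_dist (kernel_iterate (?K v) n x) (\<pi> v) \<le> \<Delta> ^ n" if "v \<in> \<U>" "n \<ge> 1" for v n x
    using assms(8) that by blast
  have vU: "v x \<in> U" if "v \<in> \<U>" for v x
    using measurable_space[OF assms(2)[rule_format, OF that], of x] by (simp add: space_restrict_space)
  \<comment> \<open>Joint measurability of \<open>c\<close> is given only over \<open>U\<close>, so
    \<open>v\<close> enters as a map into the restricted space.\<close>
  have meas: "(\<lambda>y. c (y, v y)) \<in> borel_measurable borel" if "v \<in> \<U>" for v
    using measurable_compose[OF measurable_Pair[OF measurable_ident assms(2)[rule_format, OF that]] assms(13)]
    by simp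
  obtain C where C: "\<And>x a. a \<in> U \<Longrightarrow> \<bar>c (x, a)\<bar> \<le> C"
    using assms(14) unfolding bounded_iff by fastforce
  have bnd: "\<bar>c (y, v y)\<bar> \<le> C" if "v \<in> \<U>" for v y by (rule C[OF vU[OF that]])
  have pi_lim: "(\<lambda>n. sup_dist (\<pi> (us n)) (\<pi> u)) \<longlonglongrightarrow> 0"
    by (rule sup_dist_invariant_tendsto[OF K[OF us] K[OF u] p[OF us] p[OF u] D erg[OF us] erg[OF u]])
      (use assms(12) in \<open>auto simp: controlled_kernel_def\<close>)
  \<comment> \<open>Continuity in the second variable is used along the sequence of controls at the
    fixed point \<open>y\<close>, all of whose values and limit lie in \<open>U\<close>.\<close>
  have c_lim: "(\<lambda>n. c (y, us n y)) \<longlonglongrightarrow> c (y, u y)" for y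
    by (rule continuous_on_tendsto_compose[OF assms(15)[rule_format]])
      (use assms(11) vU[OF u] vU[OF us] in auto)
  have J: "long_run_average (Pr v x) (X v) c v = ereal (\<integral>y. c (y, v y) \<partial>\<pi> v)" if v: "v \<in> \<U>" for v x
    by (rule long_run_average_eq_integral[OF proc[OF v] K[OF v] p[OF v] D erg[OF v] meas[OF v] bnd[OF v]])
  have "(\<lambda>n. \<integral>y. c (y, us n y) \<partial>\<pi> (us n)) \<longlonglongrightarrow> (\<integral>y. c (y, u y) \<partial>\<pi> u)"
    by (rule integral_tendsto_of_sup_dist[OF p[OF us] p[OF u] pi_lim meas[OF us] bnd[OF us] meas[OF u] c_lim])
  then show ?thesis using pi_lim J us u by simp
qed

end
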